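(* Let $a_1<a_2<b<c$ be positive integers such that $\{a_1,b,c\}$ and $\{a_2,b,c\}$ are $D(4)$-triples. If $c<0.25\,b^3$, then $\{a_1,a_2,b,c\}$ is a $D(4)$-quadruple.
   Context: A $D(4)$-$m$-tuple is a set of $m$ distinct positive integers such that the product of any two of its distinct elements increased by $4$ is a perfect square; for $m=3$ and $m=4$ it is called a $D(4)$-triple and a $D(4)$-quadruple respectively. *)

theory Defs
  imports Complex_Main "HOL-Computational_Algebra.Nth_Powers"
begin

definition D4_tuple :: "nat \<Rightarrow> int set \<Rightarrow> bool" where
  "D4_tuple m S \<longleftrightarrow>
     finite S \<and> card S = m \<and> (\<forall>x\<in>S. x > 0) \<and>
     (\<forall>x\<in>S. \<forall>y\<in>S. x \<noteq> y \<longrightarrow> is_square (x * y + 4))"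

abbreviation D4_triple :: "int set \<Rightarrow> bool" where
  "D4_triple \<equiv> D4_tuple 3"

abbreviation D4_quadruple :: "int set \<Rightarrow> bool" where
  "D4_quadruple \<equiv> D4_tuple 4"

end

theory Submission
  imports Defs
begin

text \<open>
  For a \<open>D(4)\<close>-triple \<open>{a, b, c}\<close> with \<open>ab + 4 = r\<^sup>2\<close>, \<open>ac + 4 = s\<^sup>2\<close>, \<open>bc + 4 = t\<^sup>2\<close>, consider the
  smaller of its two regular extensions, \<open>e = a + b + c + (abc - rst) / 2\<close>. It is a nonnegative
  integer, and \<open>ae + 4 = x\<^sup>2\<close> for the positive integer \<open>x = (rs - at) / 2\<close>. The definition of
  \<open>e\<close> reads \<open>c = tx - b + a + e\<close>, so for a fixed pair \<open>(b, c)\<close> the sum \<open>a + e\<close> has a residue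
  modulo \<open>t\<close> that depends on \<open>b\<close> and \<open>c\<close> only.

  If \<open>a < b < c < b\<^sup>3 / 4\<close>, this sum lies strictly between \<open>0\<close> and \<open>t\<close>: for \<open>e > 0\<close> one has
  \<open>abe < c\<close>, hence \<open>a + e - 1 \<le> ae < c / b < t / 2\<close>, where the last step is the bound on \<open>c\<close>.
  Two triples \<open>{a\<^sub>1, b, c}\<close> and \<open>{a\<^sub>2, b, c}\<close> thus have the same sum \<open>a\<^sub>i + e\<^sub>i\<close>, and then also
  the same \<open>x\<^sub>i\<close> and the same product \<open>a\<^sub>i e\<^sub>i = x\<^sub>i\<^sup>2 - 4\<close>. Therefore \<open>{a\<^sub>1, e\<^sub>1} = {a\<^sub>2, e\<^sub>2}\<close>, so
  \<open>a\<^sub>1 \<noteq> a\<^sub>2\<close> forces \<open>a\<^sub>2 = e\<^sub>1\<close>, and \<open>a\<^sub>1 a\<^sub>2 + 4 = x\<^sub>1\<^sup>2\<close>.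
\<close>

text \<open>Since \<open>e\<close> is symmetric in \<open>a\<close>, \<open>b\<close>, \<open>c\<close>, this identity serves for the products \<open>be\<close> and
  \<open>ce\<close> too, after a permutation of the triple.\<close>

lemma regular_extension_product:
  fixes a b c r s t e x :: int
  assumes r: "a * b + 4 = r\<^sup>2" and s: "a * c + 4 = s\<^sup>2" and t: "b * c + 4 = t\<^sup>2"
    and e: "2 * e = 2 * (a + b + c) + a * b * c - r * s * t"
    and x: "2 * x = r * s - a * t"
  shows "a * e + 4 = x\<^sup>2"
proof -
  have "4 * x\<^sup>2 = (2 * x)\<^sup>2" by (simp add: power2_eq_square)
  also have "\<dots> = r\<^sup>2 * s\<^sup>2 - 2 * a * (r * s * t) + a\<^sup>2 * t\<^sup>2"
    unfolding x by (simp add: power2_eq_square algebra_simps)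
  also have "\<dots> = (a * b + 4) * (a * c + 4) - 2 * a * (r * s * t) + a\<^sup>2 * (b * c + 4)"
    unfolding r s t ..
  also have "\<dots> = 2 * a * (2 * (a + b + c) + a * b * c - r * s * t) + 16"
    by (simp add: power2_eq_square algebra_simps)
  also have "\<dots> = 4 * (a * e + 4)"
    unfolding e[symmetric] by simp
  finally show ?thesis by simp
qed

lemma even_root_iff:
  fixes a b r :: int
  assumes "a * b + 4 = r\<^sup>2"
  shows "even r \<longleftrightarrow> even a \<or> even b"
proof -
  have "even (r\<^sup>2) \<longleftrightarrow> even (a * b + 4)" using assms by simp
  then show ?thesis by simp
qed

lemma root_product_less:
  fixes a b c r s t :: int
  assumes "0 < a" "a < b" "b < c"
    and r: "a * b + 4 = r\<^sup>2" and s: "a * c + 4 = s\<^sup>2" and t: "b * c + 4 = t\<^sup>2"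
    and "0 \<le> r" "0 \<le> s" "0 \<le> t"
  shows "a * t < r * s" "b * s < r * t"
proof -
  have sq: "(r * s)\<^sup>2 = (a * b + 4) * (a * c + 4)" "(r * t)\<^sup>2 = (a * b + 4) * (b * c + 4)"
    "(a * t)\<^sup>2 = a\<^sup>2 * (b * c + 4)" "(b * s)\<^sup>2 = b\<^sup>2 * (a * c + 4)"
    by (simp_all add: r s t power_mult_distrib)
  have "a * a < a * b" "b * b < b * c" "0 < a * c" "0 < a * b"
    using assms by simp_all
  then have "(a * t)\<^sup>2 < (r * s)\<^sup>2" "(b * s)\<^sup>2 < (r * t)\<^sup>2"
    unfolding sq by (simp_all add: power2_eq_square algebra_simps)
  then show "a * t < r * s" "b * s < r * t"
    using assms by (auto intro: power2_less_imp_less)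
qed

text \<open>Integrality is a parity count: \<open>r\<close>, \<open>s\<close>, \<open>t\<close> have the parities of \<open>ab\<close>, \<open>ac\<close>, \<open>bc\<close>. Nonnegativity
  comes from \<open>ce + 4\<close> being a square: a negative \<open>e\<close> would force \<open>c \<le> 4\<close>, and there is no
  \<open>D(4)\<close>-pair \<open>{a, b}\<close> below \<open>4\<close>.\<close>

lemma regular_extension_exists:
  fixes a b c r s t :: int
  assumes "0 < a" "a < b" "b < c"
    and r: "a * b + 4 = r\<^sup>2" and s: "a * c + 4 = s\<^sup>2" and t: "b * c + 4 = t\<^sup>2"
    and nonneg: "0 \<le> r" "0 \<le> s" "0 \<le> t"
  obtains e x y where "0 \<le> e" "0 < x" "0 < y" "a * e + 4 = x\<^sup>2" "b * e + 4 = y\<^sup>2"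
    and "2 * t = b * x + r * y" and "c = t * x - b + a + e"
proof -
  note ev = even_root_iff[OF r] even_root_iff[OF s] even_root_iff[OF t]
  have "even (2 * (a + b + c) + a * b * c - r * s * t)" "even (r * s - a * t)"
    "even (r * t - b * s)" "even (s * t - c * r)"
    using ev by auto
  then obtain e x y z where e: "2 * (a + b + c) + a * b * c - r * s * t = 2 * e"
    and x: "r * s - a * t = 2 * x" and y: "r * t - b * s = 2 * y" and z: "s * t - c * r = 2 * z"
    unfolding dvd_def by blast
  have ae: "a * e + 4 = x\<^sup>2"
    by (rule regular_extension_product[OF r s t]) (use e x in simp_all)
  have be: "b * e + 4 = y\<^sup>2"
    by (rule regular_extension_product[of b a r c t s])
      (use r s t e y in \<open>simp_all add: ac_simps\<close>)
  have ce: "c * e + 4 = z\<^sup>2"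
    by (rule regular_extension_product[of c a s b t r])
      (use r s t e z in \<open>simp_all add: ac_simps\<close>)
  have "0 \<le> e"
  proof (rule ccontr)
    assume "\<not> 0 \<le> e"
    then have "c * 1 \<le> c * (- e)" using assms by (intro mult_left_mono) auto
    moreover have "0 \<le> c * e + 4" unfolding ce by simp
    ultimately have "c \<le> 4" by simp
    then have "a = 1 \<and> b = 2 \<or> a = 1 \<and> b = 3 \<or> a = 2 \<and> b = 3" using assms by linarith
    then have "4 < r\<^sup>2" "r\<^sup>2 < 16" "r\<^sup>2 \<noteq> 9" using r by auto
    then have "2\<^sup>2 < r\<^sup>2" "r\<^sup>2 < 4\<^sup>2" "r \<noteq> 3" by auto
    then have "2 < r" "r < 4" "r \<noteq> 3"
      using nonneg(1) by (auto intro: power2_less_imp_less)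
    then show False by linarith
  qed
  moreover have "0 < x" "0 < y"
    using root_product_less[OF assms] x y by simp_all
  moreover have "2 * t = b * x + r * y"
  proof -
    have "2 * (b * x + r * y) = b * (r * s - a * t) + r * (r * t - b * s)"
      unfolding x y by (simp add: algebra_simps)
    also have "\<dots> = t * (r\<^sup>2 - a * b)" by (simp add: power2_eq_square algebra_simps)
    also have "\<dots> = 4 * t" by (simp add: r[symmetric])
    finally show ?thesis by simp
  qed
  moreover have "c = t * x - b + a + e"
  proof -
    have "2 * (t * x + e) = t * (r * s - a * t) + (2 * (a + b + c) + a * b * c - r * s * t)"
      unfolding x e by (simp add: algebra_simps)
    also have "\<dots> = 2 * (a + b + c) + a * b * c - a * t\<^sup>2"
      by (simp add: power2_eq_square algebra_simps)
    also have "\<dots> = 2 * (b + c - a)" by (simp add: t[symmetric] algebra_simps)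
    finally show ?thesis by simp
  qed
  ultimately show ?thesis using that ae be by blast
qed

text \<open>Eliminating \<open>t\<close> from the two relations of the regular extension gives
  \<open>2c = 2(a + b + e) + abe + rxy\<close>, and \<open>rxy \<ge> abe\<close> because \<open>r\<^sup>2 > ab\<close>, \<open>x\<^sup>2 > ae\<close> and \<open>y\<^sup>2 > be\<close>.\<close>

lemma regular_extension_gap:
  fixes a b c r t e x y :: int
  assumes "0 < a" "0 < b" "0 \<le> e" "0 \<le> r" "0 < x" "0 < y"
    and r: "a * b + 4 = r\<^sup>2" and x: "a * e + 4 = x\<^sup>2" and y: "b * e + 4 = y\<^sup>2"
    and t: "2 * t = b * x + r * y" and c: "c = t * x - b + a + e"
  shows "a * b * e < c"
proof -
  have "(a * b * e)\<^sup>2 = (a * b) * (a * e) * (b * e)"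
    by (simp add: power2_eq_square algebra_simps)
  also have "\<dots> \<le> r\<^sup>2 * x\<^sup>2 * y\<^sup>2"
    unfolding r[symmetric] x[symmetric] y[symmetric] using assms(1-3)
    by (intro mult_mono) auto
  also have "\<dots> = (r * x * y)\<^sup>2" by (simp add: power_mult_distrib)
  finally have rxy: "a * b * e \<le> r * x * y"
    by (rule power2_le_imp_le) (use assms in simp)
  have "2 * c = (2 * t) * x - 2 * b + 2 * a + 2 * e" using c by simp
  also have "\<dots> = b * x\<^sup>2 + r * x * y - 2 * b + 2 * a + 2 * e"
    unfolding t by (simp add: power2_eq_square algebra_simps)
  also have "\<dots> = a * b * e + r * x * y + 2 * (a + b + e)"
    unfolding x[symmetric] by (simp add: algebra_simps)
  finally have "2 * (a * b * e) + 2 * (a + b + e) \<le> 2 * c" using rxy by simp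
  then show ?thesis using assms(1-3) by simp
qed

text \<open>This is where \<open>c < b\<^sup>3 / 4\<close> enters, through \<open>(2c)\<^sup>2 < b\<^sup>3 c < (bt)\<^sup>2\<close>.\<close>

lemma regular_extension_sum_less:
  fixes a b c t e :: int
  assumes "0 < a" "a < b" "b < c" "0 \<le> e" "0 \<le> t"
    and t: "b * c + 4 = t\<^sup>2" and gap: "a * b * e < c" and cubic: "4 * c < b ^ 3"
  shows "a + e < t"
proof (cases "e = 0")
  case True
  have "b * b < b * c" using assms by simp
  then have "b\<^sup>2 < t\<^sup>2" unfolding t[symmetric] by (simp add: power2_eq_square)
  then have "b < t" using \<open>0 \<le> t\<close> by (rule power2_less_imp_less)
  then show ?thesis using True \<open>a < b\<close> by simp
next
  case False
  have "(2 * c)\<^sup>2 = (4 * c) * c" by (simp add: power2_eq_square)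
  also have "\<dots> < b ^ 3 * c" using cubic assms by (intro mult_strict_right_mono) auto
  also have "\<dots> = b\<^sup>2 * (b * c)" by (simp add: power2_eq_square power3_eq_cube)
  also have "\<dots> \<le> b\<^sup>2 * t\<^sup>2" unfolding t[symmetric] by (intro mult_left_mono) auto
  finally have "(2 * c)\<^sup>2 < (b * t)\<^sup>2" by (simp add: power_mult_distrib)
  then have "2 * c < b * t"
    by (rule power2_less_imp_less) (use assms in simp)
  then have "b * (2 * (a * e)) < b * t" using gap by (simp add: algebra_simps)
  then have "2 * (a * e) < t" using assms by simp
  moreover have "a + e \<le> a * e + 1"
  proof -
    have "0 \<le> (a - 1) * (e - 1)" using False assms by (intro mult_nonneg_nonneg) auto
    then show ?thesis by (simp add: algebra_simps)
  qed
  moreover have "1 \<le> a * e"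
    using False assms by (simp add: int_one_le_iff_zero_less)
  ultimately show ?thesis by linarith
qed

lemma D4_triple_roots:
  fixes a b c :: int
  assumes "D4_triple {a, b, c}" and "a < b" "b < c"
  obtains r s t where "a * b + 4 = r\<^sup>2" "a * c + 4 = s\<^sup>2" "b * c + 4 = t\<^sup>2"
    and "0 \<le> r" "0 \<le> s" "0 \<le> t"
proof -
  have root: "\<exists>u\<ge>0. n = u\<^sup>2" if "is_square n" for n :: int
  proof -
    from that obtain u where "n = u\<^sup>2" by (auto elim: is_nth_powerE)
    then have "n = \<bar>u\<bar>\<^sup>2" by simp
    then show ?thesis by (metis abs_ge_zero)
  qed
  have "is_square (a * b + 4)" "is_square (a * c + 4)" "is_square (b * c + 4)"
    using assms by (auto simp: D4_tuple_def)
  from this[THEN root] obtain r s t where "0 \<le> r" "a * b + 4 = r\<^sup>2" "0 \<le> s" "a * c + 4 = s\<^sup>2"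
    "0 \<le> t" "b * c + 4 = t\<^sup>2" by (elim exE conjE)
  then show ?thesis by (intro that)
qed

lemma D4_triple_small_extension:
  fixes a b c t :: int
  assumes "D4_triple {a, b, c}" and "0 < a" "a < b" "b < c" and "4 * c < b ^ 3"
    and t: "b * c + 4 = t\<^sup>2" "0 \<le> t"
  obtains e x where "0 \<le> e" "a + e < t" "a * e + 4 = x\<^sup>2" "c = t * x - b + a + e"
proof -
  obtain r s where r: "a * b + 4 = r\<^sup>2" "0 \<le> r" and s: "a * c + 4 = s\<^sup>2" "0 \<le> s"
    using D4_triple_roots assms(1,3,4) by metis
  obtain e x y where e: "0 \<le> e" "0 < x" "0 < y" "a * e + 4 = x\<^sup>2" "b * e + 4 = y\<^sup>2"
      "2 * t = b * x + r * y" "c = t * x - b + a + e"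
    using regular_extension_exists[OF assms(2-4) r(1) s(1) t(1) r(2) s(2) t(2)] by blast
  have "a * b * e < c"
    by (rule regular_extension_gap[of a b e r x y t c]) (use assms r e in auto)
  then have "a + e < t"
    using regular_extension_sum_less assms e(1) by blast
  then show ?thesis using that e by blast
qed

theorem theorem1p5:
  fixes a\<^sub>1 a\<^sub>2 b c :: int
  assumes "0 < a\<^sub>1" and "a\<^sub>1 < a\<^sub>2" and "a\<^sub>2 < b" and "b < c"
    and "D4_triple {a\<^sub>1, b, c}"
    and "D4_triple {a\<^sub>2, b, c}"
    and "real_of_int c < 0.25 * real_of_int b ^ 3"
  shows "D4_quadruple {a\<^sub>1, a\<^sub>2, b, c}"
proof -
  have "real_of_int (4 * c) < real_of_int (b ^ 3)" using assms(7) by simp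
  then have cubic: "4 * c < b ^ 3" by (simp only: of_int_less_iff)
  obtain t where t: "b * c + 4 = t\<^sup>2" "0 \<le> t"
    using D4_triple_roots[OF assms(6,3,4)] by metis
  obtain e\<^sub>1 x\<^sub>1 where 1: "0 \<le> e\<^sub>1" "a\<^sub>1 + e\<^sub>1 < t" "a\<^sub>1 * e\<^sub>1 + 4 = x\<^sub>1\<^sup>2" "c = t * x\<^sub>1 - b + a\<^sub>1 + e\<^sub>1"
    using D4_triple_small_extension[OF assms(5,1) _ assms(4) cubic t] assms(2,3) by auto
  obtain e\<^sub>2 x\<^sub>2 where 2: "0 \<le> e\<^sub>2" "a\<^sub>2 + e\<^sub>2 < t" "a\<^sub>2 * e\<^sub>2 + 4 = x\<^sub>2\<^sup>2" "c = t * x\<^sub>2 - b + a\<^sub>2 + e\<^sub>2"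
    using D4_triple_small_extension[OF assms(6) _ assms(3,4) cubic t] assms(1,2) by auto
  have "(a\<^sub>1 + e\<^sub>1) mod t = (b + c) mod t" "(a\<^sub>2 + e\<^sub>2) mod t = (b + c) mod t"
  proof -
    have "b + c = (a\<^sub>1 + e\<^sub>1) + t * x\<^sub>1" "b + c = (a\<^sub>2 + e\<^sub>2) + t * x\<^sub>2"
      using 1(4) 2(4) by linarith+
    then show "(a\<^sub>1 + e\<^sub>1) mod t = (b + c) mod t" "(a\<^sub>2 + e\<^sub>2) mod t = (b + c) mod t"
      by (metis mod_mult_self2)+
  qed
  then have sum: "a\<^sub>1 + e\<^sub>1 = a\<^sub>2 + e\<^sub>2"
    using 1(1,2) 2(1,2) assms(1,2) by simp
  then have "t * x\<^sub>1 = t * x\<^sub>2" using 1(4) 2(4) by linarith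
  then have "x\<^sub>1 = x\<^sub>2" using 1(1,2) assms(1) by simp
  then have prod: "a\<^sub>1 * e\<^sub>1 = a\<^sub>2 * e\<^sub>2" using 1(3) 2(3) by simp
  \<comment> \<open>The quadratics with roots \<open>a\<^sub>1\<close>, \<open>e\<^sub>1\<close> and \<open>a\<^sub>2\<close>, \<open>e\<^sub>2\<close> coincide, so \<open>a\<^sub>2\<close> is a root of the first.\<close>
  have "(a\<^sub>2 - a\<^sub>1) * (a\<^sub>2 - e\<^sub>1) = a\<^sub>2 * (a\<^sub>2 - (a\<^sub>1 + e\<^sub>1)) + a\<^sub>1 * e\<^sub>1"
    by (simp add: algebra_simps)
  also have "\<dots> = 0" unfolding sum prod by (simp add: algebra_simps)
  finally have "a\<^sub>2 = e\<^sub>1" using assms(2) by simp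
  then have "is_square (a\<^sub>1 * a\<^sub>2 + 4)" using 1(3) by (auto intro: is_nth_powerI)
  then show ?thesis
    using assms(1-6) by (auto simp: D4_tuple_def mult.commute)
qed

end
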